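(* Let $\gamma_0:\mathbb{S}\to\mathbb{R}^2$ be a smooth closed immersed plane curve with winding number zero, and let $T$ be the maximal time of existence of the curve diffusion flow $\gamma_t=\gamma(\cdot,t)$ with initial data $\gamma(\cdot,0)=\gamma_0$. Then $$T\le\frac{L^4(\gamma_0)}{768\pi^2},$$ where $L(\gamma_0)$ denotes the length of $\gamma_0$.
   Context: For a smooth regular plane curve, $s$ is arc length, $d\ell$ the arc length element, $\nu$ a smooth unit normal field, and $\kappa=\langle\gamma_{ss},\nu\rangle$. The curve diffusion flow is $\partial_t\gamma=-\kappa_{ss}\nu$ on $\mathbb{S}\times(0,T)$, with each $\gamma_t$ a smooth regular closed curve. Winding number zero means that the tangent has rotation index zero, i.e. $\int_{\gamma_0}\kappa\,d\ell=0$ (a property preserved along the flow). *)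

theory Defs
  imports "HOL-Analysis.Analysis"
begin

text \<open>
  \<open>C\<^sup>n\<close> on a set, by iterating directional derivatives. Derivatives are taken within \<open>S\<close>, so that
  \<open>S\<close> may contain part of its boundary; the notion is meaningful for sets such as \<open>UNIV\<close> and
  \<open>UNIV \<times> {0..<T}\<close>, on which the derivative within \<open>S\<close> is unique.
\<close>

primrec Cn_on ::
  "nat \<Rightarrow> 'a::real_normed_vector set \<Rightarrow> ('a \<Rightarrow> 'b::real_normed_vector) \<Rightarrow> bool" where
  "Cn_on 0 S f \<longleftrightarrow> continuous_on S f"
| "Cn_on (Suc n) S f \<longleftrightarrow> f differentiable_on S \<and>
     (\<forall>v. Cn_on n S (\<lambda>x. frechet_derivative f (at x within S) v))"

definition smooth_on ::
  "'a::real_normed_vector set \<Rightarrow> ('a \<Rightarrow> 'b::real_normed_vector) \<Rightarrow> bool" where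
  "smooth_on S f \<longleftrightarrow> (\<forall>n. Cn_on n S f)"

text \<open>
  The circle is \<open>\<real>/\<int>\<close>: a map on the circle is a map on the real line of period 1.
\<close>

definition closed_immersed_curve :: "(real \<Rightarrow> real^2) \<Rightarrow> bool" where
  "closed_immersed_curve \<gamma> \<longleftrightarrow>
     smooth_on UNIV \<gamma> \<and> (\<forall>x. \<gamma> (x + 1) = \<gamma> x) \<and> (\<forall>x. vector_derivative \<gamma> (at x) \<noteq> 0)"

definition speed :: "(real \<Rightarrow> real^2) \<Rightarrow> real \<Rightarrow> real" where
  "speed \<gamma> x = norm (vector_derivative \<gamma> (at x))"

definition arc_deriv ::
  "(real \<Rightarrow> real^2) \<Rightarrow> (real \<Rightarrow> 'b::real_normed_vector) \<Rightarrow> real \<Rightarrow> 'b" where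
  "arc_deriv \<gamma> f x = vector_derivative f (at x) /\<^sub>R speed \<gamma> x"

text \<open>
  The unit normal is the unit tangent rotated by \<open>\<pi>/2\<close>. The only other smooth unit normal field is
  its negative, which flips the sign of the curvature and leaves both the flow equation and the
  vanishing of the rotation index unchanged.
\<close>

definition unit_normal :: "(real \<Rightarrow> real^2) \<Rightarrow> real \<Rightarrow> real^2" where
  "unit_normal \<gamma> x = vector [- (arc_deriv \<gamma> \<gamma> x $ 2), arc_deriv \<gamma> \<gamma> x $ 1]"

definition curvature :: "(real \<Rightarrow> real^2) \<Rightarrow> real \<Rightarrow> real" where
  "curvature \<gamma> x = arc_deriv \<gamma> (arc_deriv \<gamma> \<gamma>) x \<bullet> unit_normal \<gamma> x"

definition curve_length :: "(real \<Rightarrow> real^2) \<Rightarrow> real" where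
  "curve_length \<gamma> = integral {0..1} (speed \<gamma>)"

definition rotation_index :: "(real \<Rightarrow> real^2) \<Rightarrow> real" where
  "rotation_index \<gamma> = integral {0..1} (\<lambda>x. curvature \<gamma> x * speed \<gamma> x) / (2 * pi)"

text \<open>
  The curve at time \<open>t\<close> is \<open>\<gamma> t\<close>. Smoothness is required up to the initial time, as is standard for
  smooth initial data.
\<close>

definition curve_diffusion_flow :: "real \<Rightarrow> (real \<Rightarrow> real \<Rightarrow> real^2) \<Rightarrow> bool" where
  "curve_diffusion_flow T \<gamma> \<longleftrightarrow>
     smooth_on (UNIV \<times> {0..<T}) (\<lambda>(x, t). \<gamma> t x) \<and>
     (\<forall>t\<in>{0..<T}. closed_immersed_curve (\<gamma> t)) \<and>
     (\<forall>t\<in>{0<..<T}. \<forall>x.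
        ((\<lambda>t. \<gamma> t x) has_vector_derivative
           - (arc_deriv (\<gamma> t) (arc_deriv (\<gamma> t) (curvature (\<gamma> t))) x *\<^sub>R unit_normal (\<gamma> t) x)) (at t))"

definition maximal_existence_time :: "(real \<Rightarrow> real^2) \<Rightarrow> ereal" where
  "maximal_existence_time \<gamma>\<^sub>0 =
     Sup {ereal T | T. T > 0 \<and> (\<exists>\<gamma>. curve_diffusion_flow T \<gamma> \<and> \<gamma> 0 = \<gamma>\<^sub>0)}"

end

theory Submission
  imports Defs
begin

text \<open>
  Along the flow \<open>L' = - \<integral> \<kappa>\<^sub>s\<^sup>2 ds\<close>, so it suffices that \<open>L\<^sup>3 \<integral> \<kappa>\<^sub>s\<^sup>2 ds \<ge> 192 \<pi>\<^sup>2\<close> for a closed curve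
  of rotation index zero: then \<open>(L\<^sup>4)' \<le> - 768 \<pi>\<^sup>2\<close>. For such a curve the tangent angle \<open>\<theta>\<close> is a
  periodic function of \<open>s\<close> with \<open>\<theta>\<^sub>s = \<kappa>\<close>, which may be shifted to have mean zero. Since the curve
  closes up, \<open>\<integral> cos \<theta> ds = 0\<close>, and \<open>cos \<theta> \<ge> 1 - \<theta>\<^sup>2 / 2\<close> gives \<open>\<integral> \<theta>\<^sup>2 ds \<ge> 2 L\<close>. Wirtinger's
  inequality for \<open>\<theta>\<close> and then for \<open>\<kappa>\<close> yields
  \<open>L\<^sup>3 \<integral> \<kappa>\<^sub>s\<^sup>2 ds \<ge> L\<^sup>3 (2\<pi>/L)\<^sup>4 2 L = 32 \<pi>\<^sup>4 \<ge> 192 \<pi>\<^sup>2\<close>. The rotation index stays zero because it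
  is an integer depending continuously on time.
\<close>

section \<open>Wirtinger's inequality with a weight\<close>

lemma continuous_imp_primitive:
  fixes f :: "real \<Rightarrow> real"
  assumes cont: "\<And>x. isCont f x"
  obtains F where "\<And>x. (F has_real_derivative f x) (at x)"
proof
  \<comment> \<open>Integrals over empty or one-point intervals are 0, so at most one of the two
    terms survives: this is the oriented integral from 0 to \<open>x\<close>.\<close>
  define F where "F = (\<lambda>x. integral {0..x} f - integral {x..0} f)"
  have co: "continuous_on S f" for S
    using cont continuous_at_imp_continuous_on by blast
  fix x :: real
  \<comment> \<open>Both 0 and the given point lie strictly inside \<open>{-N<..<N}\<close>; there
    \<open>F\<close> differs by a constant from an integral with a fixed lower end.\<close>
  define N where "N = \<bar>x\<bar> + 1"
  have F_eq: "F y = integral {-N..y} f - integral {-N..0} f" if y: "y \<in> {-N<..<N}" for y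
  proof (cases "0 \<le> y")
    case True
    have "integral {-N..0} f + integral {0..y} f = integral {-N..y} f"
      using True y by (intro Henstock_Kurzweil_Integration.integral_combine integrable_continuous_real co) (auto simp: N_def)
    moreover have "integral {y..0} f = 0"
      using True by (cases "y = 0") auto
    ultimately show ?thesis by (simp add: F_def)
  next
    case False
    have "integral {-N..y} f + integral {y..0} f = integral {-N..0} f"
      using False y by (intro Henstock_Kurzweil_Integration.integral_combine integrable_continuous_real co) auto
    then show ?thesis using False by (simp add: F_def)
  qed
  have "((\<lambda>y. integral {-N..y} f) has_vector_derivative f x) (at x within {-N..N})"
    by (rule integral_has_vector_derivative[OF co]) (auto simp: N_def)
  moreover have "at x within {-N..N} = at x"
    by (rule at_within_interior) (auto simp: N_def)
  ultimately have "((\<lambda>y. integral {-N..y} f) has_real_derivative f x) (at x)"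
    by (simp add: has_real_derivative_iff_has_vector_derivative)
  then have "((\<lambda>y. integral {-N..y} f - integral {-N..0} f) has_real_derivative f x) (at x)"
    by (auto intro!: derivative_eq_intros)
  then show "(F has_real_derivative f x) (at x)"
    by (rule has_field_derivative_transform_within_open[where S="{-N<..<N}"])
       (auto simp: F_eq, auto simp: N_def)
qed

lemma has_integral_real_FTC:
  fixes F f :: "real \<Rightarrow> real"
  assumes "\<And>x. (F has_real_derivative f x) (at x)" "a \<le> b"
  shows "(f has_integral (F b - F a)) {a..b}"
  using assms
  by (intro fundamental_theorem_of_calculus)
     (auto simp: has_real_derivative_iff_has_vector_derivative intro: has_vector_derivative_at_within)

lemma DERIV_periodic:
  fixes f f' :: "real \<Rightarrow> real"
  assumes "\<And>x. (f has_real_derivative f' x) (at x)" "\<And>x. f (x + 1) = f x"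
  shows "f' (x + 1) = f' x"
proof -
  have "((\<lambda>x. f (x + 1)) has_real_derivative f' (x + 1)) (at x)"
    using assms(1)[of "x + 1"] by (simp add: DERIV_shift)
  then show ?thesis
    using assms DERIV_unique by (metis (no_types, lifting) ext)
qed

text \<open>The increment of \<open>F\<close> over one period has derivative zero by periodicity of
  \<open>f\<close>, so it equals its value at 0.\<close>

lemma primitive_periodic:
  fixes F f :: "real \<Rightarrow> real"
  assumes "\<And>x. (F has_real_derivative f x) (at x)" "\<And>x. f (x + 1) = f x"
  shows "F (x + 1) = F x + integral {0..1} f"
proof -
  have "((\<lambda>x. F (x + 1) - F x) has_real_derivative 0) (at x)" for x
    using assms(1)[of "x + 1"] assms(1)[of x] assms(2)[of x]
    by (auto simp: DERIV_shift[symmetric] intro!: derivative_eq_intros)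
  then have "F (x + 1) - F x = F (0 + 1) - F 0"
    using DERIV_isconst_all[of "\<lambda>x. F (x + 1) - F x"] by blast
  moreover have "integral {0..1} f = F 1 - F 0"
    using has_integral_real_FTC[OF assms(1), of 0 1] by (simp add: integral_unique)
  ultimately show ?thesis by simp
qed

lemma has_integral_shift_period:
  fixes f :: "real \<Rightarrow> real"
  assumes "\<And>x. isCont f x" "\<And>x. f (x + 1) = f x"
  shows "(f has_integral integral {0..1} f) {a..a + 1}"
proof -
  obtain F where F: "\<And>x. (F has_real_derivative f x) (at x)"
    using continuous_imp_primitive assms(1) by blast
  show ?thesis
    using has_integral_real_FTC[OF F, of a "a + 1"] primitive_periodic[OF F assms(2), of a] by simp
qed

text \<open>Jacobi's completion of the square:
  \<open>g'\<^sup>2 / v - \<omega>\<^sup>2 g\<^sup>2 v + (\<omega> g\<^sup>2 tan u)' = (g' / v + \<omega> g tan u)\<^sup>2 v\<close>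
  where \<open>u' = \<omega> v\<close> and \<open>\<bar>u\<bar> < \<pi>/2\<close>.\<close>

lemma weighted_Dirichlet_Poincare:
  fixes g g' S v :: "real \<Rightarrow> real"
  assumes g: "\<And>x. (g has_real_derivative g' x) (at x)"
    and S: "\<And>x. (S has_real_derivative v x) (at x)"
    and v: "\<And>x. v x > 0" and cont: "\<And>x. isCont v x" "\<And>x. isCont g' x"
    and "a \<le> b" "g a = 0" "g b = 0"
    and \<omega>: "\<omega> > 0" "\<omega> * (S b - S a) < pi"
  shows "\<omega>\<^sup>2 * integral {a..b} (\<lambda>x. (g x)\<^sup>2 * v x) \<le> integral {a..b} (\<lambda>x. (g' x)\<^sup>2 / v x)"
proof -
  \<comment> \<open>Centring at the midpoint of \<open>S a\<close> and \<open>S b\<close> keeps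
    \<open>u\<close> within \<open>\<omega> * (S b - S a) / 2 < pi / 2\<close> of 0, so the tangent
    has no pole on the interval.\<close>
  define u where "u x = \<omega> * (S x - (S a + S b) / 2)" for x
  define \<tau> where "\<tau> x = tan (u x)" for x
  define G where "G x = \<omega> * (g x)\<^sup>2 * \<tau> x" for x
  define h where "h x = 2 * \<omega> * g x * g' x * \<tau> x + \<omega>\<^sup>2 * (g x)\<^sup>2 * v x * (1 + (\<tau> x)\<^sup>2)" for x
  have S_mono: "S x \<le> S y" if "x \<le> y" for x y
    using that S v by (intro DERIV_nonneg_imp_nondecreasing[of x y S]) (force intro: less_imp_le)+
  have u: "-(pi/2) < u x \<and> u x < pi/2" if "x \<in> {a..b}" for x
  proof -
    have "S a \<le> S x" "S x \<le> S b" using that S_mono by auto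
    then have "\<bar>S x - (S a + S b) / 2\<bar> \<le> (S b - S a) / 2"
      by (auto simp: abs_le_iff field_simps)
    then have "\<omega> * \<bar>S x - (S a + S b) / 2\<bar> \<le> \<omega> * ((S b - S a) / 2)"
      using \<omega> by (intro mult_left_mono) auto
    moreover have "\<bar>u x\<bar> = \<omega> * \<bar>S x - (S a + S b) / 2\<bar>"
      using \<omega> by (simp add: u_def abs_mult)
    moreover have "\<omega> * ((S b - S a) / 2) < pi / 2"
      using \<omega> by simp
    ultimately have "\<bar>u x\<bar> < pi / 2" by linarith
    then show ?thesis by linarith
  qed
  have G: "(G has_real_derivative h x) (at x)" if "x \<in> {a..b}" for x
  proof -
    have "cos (u x) \<noteq> 0" using u[OF that] cos_gt_zero_pi by force
    moreover have "(u has_real_derivative \<omega> * v x) (at x)"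
      unfolding u_def[abs_def] by (auto intro!: derivative_eq_intros S)
    ultimately have "(\<tau> has_real_derivative (1 + (\<tau> x)\<^sup>2) * (\<omega> * v x)) (at x)"
      unfolding \<tau>_def[abs_def] by (auto intro!: derivative_eq_intros simp: tan_sec power_inverse)
    then show ?thesis
      unfolding G_def[abs_def] h_def
      by (auto intro!: derivative_eq_intros g simp: algebra_simps power2_eq_square)
  qed
  have "(h has_integral (G b - G a)) {a..b}"
    using G \<open>a \<le> b\<close>
    by (intro fundamental_theorem_of_calculus)
       (auto simp: has_real_derivative_iff_has_vector_derivative intro: has_vector_derivative_at_within)
  \<comment> \<open>The boundary terms of \<open>G\<close> vanish because \<open>g\<close> is zero
    at both ends, which also covers the values of the tangent there.\<close>
  then have h: "(h has_integral 0) {a..b}"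
    using assms by (simp add: G_def)
  have gc: "isCont g x" for x using g DERIV_isCont by blast
  have I1: "(\<lambda>x. (g x)\<^sup>2 * v x) integrable_on {a..b}" and I2: "(\<lambda>x. (g' x)\<^sup>2 / v x) integrable_on {a..b}"
    using v by (auto intro!: integrable_continuous_real continuous_at_imp_continuous_on
        continuous_intros cont gc simp: less_imp_neq[THEN not_sym])
  have "((\<lambda>x. (g' x)\<^sup>2 / v x - \<omega>\<^sup>2 * ((g x)\<^sup>2 * v x) + h x) has_integral
     (integral {a..b} (\<lambda>x. (g' x)\<^sup>2 / v x) - \<omega>\<^sup>2 * integral {a..b} (\<lambda>x. (g x)\<^sup>2 * v x) + 0)) {a..b}"
    by (intro has_integral_add has_integral_diff has_integral_mult_right h integrable_integral I1 I2)
  moreover have "(g' x)\<^sup>2 / v x - \<omega>\<^sup>2 * ((g x)\<^sup>2 * v x) + h x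
      = (g' x / v x + \<omega> * g x * \<tau> x)\<^sup>2 * v x" for x
    using v[of x] by (simp add: h_def field_simps power2_eq_square)
  ultimately have "((\<lambda>x. (g' x / v x + \<omega> * g x * \<tau> x)\<^sup>2 * v x) has_integral
     (integral {a..b} (\<lambda>x. (g' x)\<^sup>2 / v x) - \<omega>\<^sup>2 * integral {a..b} (\<lambda>x. (g x)\<^sup>2 * v x))) {a..b}"
    by simp
  from has_integral_nonneg[OF this] show ?thesis
    using v by (simp add: less_imp_le)
qed

text \<open>The classical inequality in arc length, transported to the parameter \<open>x\<close>
  with density \<open>v\<close>. The closed curve is cut into two arcs of half length whose ends
  share one value of \<open>f\<close>. Subtracting that value gives a Dirichlet problem on each arc,
  and its constant, pi divided by half the length, is exactly the periodic one.\<close>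

lemma weighted_Wirtinger:
  fixes f f' v :: "real \<Rightarrow> real"
  assumes f: "\<And>x. (f has_real_derivative f' x) (at x)" and f_per: "\<And>x. f (x + 1) = f x"
    and v: "\<And>x. v x > 0" and v_per: "\<And>x. v (x + 1) = v x"
    and cont: "\<And>x. isCont v x" "\<And>x. isCont f' x"
    and mean: "integral {0..1} (\<lambda>x. f x * v x) = 0"
  shows "(2 * pi / integral {0..1} v)\<^sup>2 * integral {0..1} (\<lambda>x. (f x)\<^sup>2 * v x)
           \<le> integral {0..1} (\<lambda>x. (f' x)\<^sup>2 / v x)"
proof -
  define L where "L = integral {0..1} v"
  obtain S where S: "\<And>x. (S has_real_derivative v x) (at x)"
    using continuous_imp_primitive cont(1) by blast
  have S1: "S (x + 1) = S x + L" for x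
    unfolding L_def by (rule primitive_periodic[OF S v_per])
  have S_mono: "S x < S y" if "x < y" for x y
    using that S v by (intro DERIV_pos_imp_increasing[of x y S]) force+
  have S_le: "x \<le> y" if "S x \<le> S y" for x y
    using S_mono[of y x] that by force
  have L: "L > 0" using S1[of 0] S_mono[of 0 1] by simp
  have fc: "isCont f x" for x using f DERIV_isCont by blast
  have Sc: "continuous_on X S" for X using S DERIV_isCont continuous_at_imp_continuous_on by blast
  \<comment> \<open>two points that halve the curve and at which \<open>f\<close> agrees\<close>
  obtain a b where ab: "a \<le> b" "b \<le> a + 1" "f a = f b" "S b - S a = L / 2"
  proof -
    \<comment> \<open>\<open>\<phi>\<close> inverts arc length on one period, so that points can be
      moved by exactly half the length.\<close>
    define \<phi> where "\<phi> = inv_into {0..1} S"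
    have inj: "inj_on S {0..1}" using S_mono by (metis inj_onI less_irrefl neqE)
    have img: "S ` {0..1} = {S 0..S 0 + L}"
    proof
      show "S ` {0..1} \<subseteq> {S 0..S 0 + L}"
        using S_mono S1[of 0] by (force simp: order.order_iff_strict)
      show "{S 0..S 0 + L} \<subseteq> S ` {0..1}"
      proof
        fix y assume "y \<in> {S 0..S 0 + L}"
        then obtain x where "0 \<le> x" "x \<le> 1" "S x = y"
          using IVT'[of S 0 y 1] S1[of 0] Sc by auto
        then show "y \<in> S ` {0..1}" by auto
      qed
    qed
    have \<phi>c: "continuous_on {S 0..S 0 + L} \<phi>"
      using continuous_on_inv[OF Sc compact_Icc, of 0 1 \<phi>] inj img by (simp add: \<phi>_def)
    have \<phi>: "S (\<phi> y) = y" "\<phi> y \<in> {0..1}" if "y \<in> {S 0..S 0 + L}" for y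
      using that img unfolding \<phi>_def by (metis f_inv_into_f, metis inv_into_into)
    have \<phi>0: "\<phi> (S 0) = 0" and \<phi>1: "\<phi> (S 0 + L) = 1"
      using inv_into_f_f[OF inj, of 0] inv_into_f_f[OF inj, of 1] S1[of 0] by (auto simp: \<phi>_def)
    \<comment> \<open>\<open>h\<close> compares \<open>f\<close> at points half a length apart.
      Since \<open>f\<close> is periodic, the values of \<open>h\<close> at \<open>S 0\<close> and
      \<open>S 0 + L / 2\<close> are opposite, and the intermediate value theorem yields a
      zero.\<close>
    define h where "h y = f (\<phi> y) - f (\<phi> (y + L / 2))" for y
    have fcon: "continuous_on UNIV f" by (simp add: continuous_on_eq_continuous_at fc)
    have "continuous_on {S 0..S 0 + L / 2} h"
      unfolding h_def
      by (intro continuous_intros continuous_on_compose2[OF fcon] continuous_on_compose2[OF \<phi>c])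
         (use L in auto)
    moreover have "h (S 0 + L / 2) = - h (S 0)"
      using f_per[of 0] by (simp add: h_def \<phi>0 \<phi>1 add.assoc)
    ultimately obtain y where y: "S 0 \<le> y" "y \<le> S 0 + L / 2" "h y = 0"
      using IVT'[of h "S 0" 0 "S 0 + L / 2"] IVT2'[of h "S 0 + L / 2" 0 "S 0"] L
      by (cases "h (S 0) \<le> 0") force+
    show ?thesis
    proof
      show "f (\<phi> y) = f (\<phi> (y + L / 2))" using y(3) by (simp add: h_def)
      have y2: "y \<in> {S 0..S 0 + L}" "y + L / 2 \<in> {S 0..S 0 + L}" using y L by auto
      show diff: "S (\<phi> (y + L / 2)) - S (\<phi> y) = L / 2" using \<phi>(1)[OF y2(1)] \<phi>(1)[OF y2(2)] by linarith
      show "\<phi> y \<le> \<phi> (y + L / 2)" by (rule S_le) (use diff L in linarith)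
      show "\<phi> (y + L / 2) \<le> \<phi> y + 1" using \<phi>(2)[OF y2(1)] \<phi>(2)[OF y2(2)] by simp
    qed
  qed
  define g where "g x = f x - f a" for x
  have g: "(g has_real_derivative f' x) (at x)" for x
    unfolding g_def[abs_def] by (auto intro!: derivative_eq_intros f)
  have g_per: "g (x + 1) = g x" for x by (simp add: g_def f_per)
  have f'_per: "f' (x + 1) = f' x" for x by (rule DERIV_periodic[OF f f_per])
  have gc: "isCont g x" for x using g DERIV_isCont by blast
  define A where "A = (\<lambda>x. (g x)\<^sup>2 * v x)"
  define B where "B = (\<lambda>x. (f' x)\<^sup>2 / v x)"
  have Ac: "isCont A x" and Bc: "isCont B x" for x
    using v[of x] unfolding A_def B_def by (auto intro!: continuous_intros gc cont)
  have Ai: "A integrable_on {x..y}" and Bi: "B integrable_on {x..y}" for x y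
    using Ac Bc by (auto intro!: integrable_continuous_real continuous_at_imp_continuous_on)
  have shift: "integral {0..1} A = integral {a..b} A + integral {b..a + 1} A"
     "integral {0..1} B = integral {a..b} B + integral {b..a + 1} B"
    using has_integral_shift_period[of A a] has_integral_shift_period[of B a] Ac Bc
      Henstock_Kurzweil_Integration.integral_combine[OF ab(1,2) Ai]
      Henstock_Kurzweil_Integration.integral_combine[OF ab(1,2) Bi]
    by (auto simp: A_def B_def g_per v_per f'_per dest: integral_unique)
  \<comment> \<open>The Dirichlet inequality requires \<open>\<omega> * (L / 2) < pi\<close>
    strictly, so the sharp constant is reached as a limit from the left.\<close>
  have below: "\<omega>\<^sup>2 * integral {0..1} A \<le> integral {0..1} B" if \<omega>: "0 < \<omega>" "\<omega> < 2 * pi / L" for \<omega>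
  proof -
    have "\<omega> * (L / 2) < pi" "g a = 0" "g b = 0" "g (a + 1) = 0"
      using \<omega> L ab(3) f_per[of a] by (auto simp: field_simps g_def)
    moreover have "S (a + 1) - S b = L / 2" using S1[of a] ab(4) by linarith
    ultimately have "\<omega>\<^sup>2 * integral {a..b} A \<le> integral {a..b} B"
      "\<omega>\<^sup>2 * integral {b..a + 1} A \<le> integral {b..a + 1} B"
      unfolding A_def B_def using ab(1,2,4) \<omega>(1)
      by (intro weighted_Dirichlet_Poincare[OF g S v cont]; simp only:)+
    then show ?thesis unfolding shift by (simp add: algebra_simps)
  qed
  have "((\<lambda>\<omega>. \<omega>\<^sup>2 * integral {0..1} A) \<longlongrightarrow> (2 * pi / L)\<^sup>2 * integral {0..1} A) (at_left (2 * pi / L))"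
    by (intro tendsto_intros)
  moreover have "\<forall>\<^sub>F \<omega> in at_left (2 * pi / L). \<omega>\<^sup>2 * integral {0..1} A \<le> integral {0..1} B"
    using eventually_at_left_real[of 0 "2 * pi / L"] L below by (auto elim!: eventually_mono)
  ultimately have *: "(2 * pi / L)\<^sup>2 * integral {0..1} A \<le> integral {0..1} B"
    by (intro tendsto_upperbound[of _ _ "at_left (2 * pi / L)"]) auto
  have If: "(\<lambda>x. (f x)\<^sup>2 * v x) integrable_on {0..1}" "(\<lambda>x. f x * v x) integrable_on {0..1}" "v integrable_on {0..1}"
    by (auto intro!: integrable_continuous_real continuous_at_imp_continuous_on continuous_intros fc cont)
  \<comment> \<open>Expanding the square in \<open>A\<close>: mean zero kills the cross term and the
    shift only adds \<open>(f a)\<^sup>2 * L\<close>, so the bound for the shifted function passes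
    to \<open>f\<close>.\<close>
  have "((\<lambda>x. (f x)\<^sup>2 * v x - 2 * f a * (f x * v x) + (f a)\<^sup>2 * v x) has_integral
      (integral {0..1} (\<lambda>x. (f x)\<^sup>2 * v x) - 2 * f a * integral {0..1} (\<lambda>x. f x * v x) + (f a)\<^sup>2 * L)) {0..1}"
    unfolding L_def by (intro has_integral_add has_integral_diff has_integral_mult_right integrable_integral If)
  moreover have "(\<lambda>x. (f x)\<^sup>2 * v x - 2 * f a * (f x * v x) + (f a)\<^sup>2 * v x) = A"
    by (simp add: A_def g_def fun_eq_iff power2_eq_square algebra_simps)
  ultimately have "integral {0..1} A = integral {0..1} (\<lambda>x. (f x)\<^sup>2 * v x) + (f a)\<^sup>2 * L"
    using mean by (simp add: integral_unique)
  then have "integral {0..1} (\<lambda>x. (f x)\<^sup>2 * v x) \<le> integral {0..1} A" using L by simp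
  then have "(2 * pi / L)\<^sup>2 * integral {0..1} (\<lambda>x. (f x)\<^sup>2 * v x) \<le> (2 * pi / L)\<^sup>2 * integral {0..1} A"
    by (intro mult_left_mono) auto
  with * show ?thesis by (simp add: L_def B_def)
qed

section \<open>Closed plane curves\<close>

lemma has_vector_derivative_vector_2_iff:
  fixes f :: "real \<Rightarrow> real^2"
  shows "(f has_vector_derivative D) (at x within S) \<longleftrightarrow>
     ((\<lambda>x. f x $ 1) has_vector_derivative D $ 1) (at x within S) \<and> ((\<lambda>x. f x $ 2) has_vector_derivative D $ 2) (at x within S)"
proof -
  have "(f has_vector_derivative D) (at x within S) \<longleftrightarrow>
      (\<forall>i. ((\<lambda>x. f x $ i) has_vector_derivative D $ i) (at x within S))"
    unfolding has_vector_derivative_def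
    by (subst has_derivative_componentwise_within) (auto simp: Basis_vec_def inner_axis)
  then show ?thesis by (simp add: forall_2)
qed

text \<open>Half-angle form of the cosine together with
  \<open>\<bar>sin y\<bar> \<le> \<bar>y\<bar>\<close>.\<close>

lemma cos_ge_quadratic: "0 \<le> x\<^sup>2 - 2 + 2 * cos x" for x :: real
proof -
  have "(sin (x / 2))\<^sup>2 \<le> (x / 2)\<^sup>2"
    using abs_sin_x_le_abs_x[of "x / 2"] by (simp add: abs_le_square_iff[symmetric])
  then show ?thesis
    using cos_double_sin[of "x / 2"] by (simp add: power_divide)
qed

text \<open>The functions \<open>p, q\<close> to \<open>p3, q3\<close> are the coordinates of the
  first four derivatives of \<open>c\<close>, the order at which the second arc length derivative of
  the curvature lives. They turn the geometric quantities into explicit quotients.\<close>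

locale plane_curve =
  fixes c :: "real \<Rightarrow> real^2" and p q p1 q1 p2 q2 p3 q3 :: "real \<Rightarrow> real"
  assumes c: "\<And>x. (c has_vector_derivative vector [p x, q x]) (at x)"
    and p: "\<And>x. (p has_real_derivative p1 x) (at x)"
    and q: "\<And>x. (q has_real_derivative q1 x) (at x)"
    and p1: "\<And>x. (p1 has_real_derivative p2 x) (at x)"
    and q1: "\<And>x. (q1 has_real_derivative q2 x) (at x)"
    and p2: "\<And>x. (p2 has_real_derivative p3 x) (at x)"
    and q2: "\<And>x. (q2 has_real_derivative q3 x) (at x)"
    and immersed: "\<And>x. (p x)\<^sup>2 + (q x)\<^sup>2 > 0"
    and periodic: "\<And>x. c (x + 1) = c x"
begin

definition v where "v x = sqrt ((p x)\<^sup>2 + (q x)\<^sup>2)"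
text \<open>\<open>D\<close> is the determinant and \<open>E\<close> the inner product of the first
  two derivatives of \<open>c\<close>; thus \<open>2 * E\<close> is the derivative of
  \<open>v\<^sup>2\<close>, and \<open>D / v ^ 3\<close> is the signed curvature.\<close>

definition D where "D x = p x * q1 x - q x * p1 x"
definition E where "E x = p x * p1 x + q x * q1 x"
definition k where "k x = D x / v x ^ 3"
text \<open>The prime denotes the derivative in the parameter, the suffixes \<open>s\<close> and
  \<open>ss\<close> those in arc length. \<open>kss\<close> keeps an abstract derivative, since the
  later arguments use it only through \<open>ks_deriv\<close>.\<close>

definition k' where "k' x = (p x * q2 x - q x * p2 x) / v x ^ 3 - 3 * D x * E x / v x ^ 5"
definition ks where "ks x = k' x / v x"
definition kss where "kss x = vector_derivative ks (at x) / v x"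

lemma v_pos: "v x > 0"
  by (simp add: v_def immersed)

lemma v_sq: "(v x)\<^sup>2 = (p x)\<^sup>2 + (q x)\<^sup>2"
  using immersed[of x] by (simp add: v_def less_imp_le)

lemma unit_tangent: "(p x / v x)\<^sup>2 + (q x / v x)\<^sup>2 = 1"
  using v_pos[of x] by (simp add: power_divide add_divide_distrib[symmetric] flip: v_sq)

lemma v_deriv: "(v has_real_derivative E x / v x) (at x)"
proof -
  have "((\<lambda>x. (p x)\<^sup>2 + (q x)\<^sup>2) has_real_derivative 2 * E x) (at x)"
    by (auto intro!: derivative_eq_intros p q simp: E_def algebra_simps)
  from DERIV_chain2[OF DERIV_real_sqrt[OF immersed] this] show ?thesis
    by (simp add: v_def[abs_def] field_simps)
qed

lemma D_deriv: "(D has_real_derivative (p x * q2 x - q x * p2 x)) (at x)"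
  unfolding D_def[abs_def] by (auto intro!: derivative_eq_intros p q p1 q1)

lemma k_deriv: "(k has_real_derivative k' x) (at x)"
  unfolding k_def[abs_def] k'_def using v_pos[of x]
  by (auto intro!: derivative_eq_intros D_deriv v_deriv simp: field_simps eval_nat_numeral)

text \<open>First coordinate of the Frenet equation: the unit tangent turns towards the normal at
  rate \<open>k * v\<close>. Clearing denominators leaves a polynomial identity once
  \<open>v\<^sup>2\<close> is expanded. The second coordinate is treated alike.\<close>

lemma p_v_deriv: "((\<lambda>x. p x / v x) has_real_derivative - (q x / v x) * (k x * v x)) (at x)"
proof -
  have "p1 x * (v x)\<^sup>2 - p x * E x = - (q x * D x)"
    unfolding v_sq E_def D_def by algebra
  moreover have "(p1 x * v x - p x * (E x / v x)) / (v x * v x) = (p1 x * (v x)\<^sup>2 - p x * E x) / v x ^ 3"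
    "- (q x / v x) * (k x * v x) = (- (q x * D x)) / v x ^ 3"
    unfolding k_def using v_pos[of x] by (simp_all add: field_simps eval_nat_numeral)
  ultimately have "(p1 x * v x - p x * (E x / v x)) / (v x * v x) = - (q x / v x) * (k x * v x)"
    by simp
  then show ?thesis
    using v_pos[of x] by (auto intro!: derivative_eq_intros p v_deriv)
qed

lemma q_v_deriv: "((\<lambda>x. q x / v x) has_real_derivative (p x / v x) * (k x * v x)) (at x)"
proof -
  have "q1 x * (v x)\<^sup>2 - q x * E x = p x * D x"
    unfolding v_sq E_def D_def by algebra
  moreover have "(q1 x * v x - q x * (E x / v x)) / (v x * v x) = (q1 x * (v x)\<^sup>2 - q x * E x) / v x ^ 3"
    "(p x / v x) * (k x * v x) = (p x * D x) / v x ^ 3"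
    unfolding k_def using v_pos[of x] by (simp_all add: field_simps eval_nat_numeral)
  ultimately have "(q1 x * v x - q x * (E x / v x)) / (v x * v x) = (p x / v x) * (k x * v x)"
    by simp
  then show ?thesis
    using v_pos[of x] by (auto intro!: derivative_eq_intros q v_deriv)
qed

lemma ks_differentiable: "ks differentiable (at x)"
proof -
  have "p differentiable (at x)" "q differentiable (at x)" "p1 differentiable (at x)"
    "q1 differentiable (at x)" "p2 differentiable (at x)" "q2 differentiable (at x)"
    "v differentiable (at x)"
    unfolding real_differentiable_def using p q p1 q1 p2 q2 v_deriv by blast+
  then show ?thesis
    unfolding ks_def[abs_def] k'_def D_def E_def using v_pos[of x]
    by (intro differentiable_divide differentiable_diff differentiable_mult differentiable_power
        differentiable_add differentiable_const) auto
qed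

lemma ks_deriv: "(ks has_real_derivative kss x * v x) (at x)"
  using ks_differentiable[of x] v_pos[of x]
  by (simp add: kss_def has_real_derivative_iff_has_vector_derivative vector_derivative_works)

section \<open>Agreement of the coordinate formulas with the geometric definitions\<close>

lemma speed_eq: "speed c = v"
  by (simp add: fun_eq_iff speed_def v_def vector_derivative_at[OF c] norm_vec_def L2_set_def sum_2)

lemma arc_deriv_eq:
  assumes "\<And>x. (f has_vector_derivative f' x) (at x)"
  shows "arc_deriv c f x = f' x /\<^sub>R v x"
  using assms by (simp add: arc_deriv_def speed_eq vector_derivative_at)

lemma tangent_eq: "arc_deriv c c = (\<lambda>x. vector [p x / v x, q x / v x])"
  by (rule ext, subst arc_deriv_eq[OF c]) (simp add: vec_eq_iff forall_2 divide_inverse)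

lemma normal_eq: "unit_normal c x = vector [- (q x / v x), p x / v x]"
  by (simp add: unit_normal_def tangent_eq)

lemma tangent_deriv: "(arc_deriv c c has_vector_derivative (k x * v x) *\<^sub>R unit_normal c x) (at x)"
  using p_v_deriv[of x] q_v_deriv[of x]
  by (simp add: has_vector_derivative_vector_2_iff tangent_eq normal_eq
      has_real_derivative_iff_has_vector_derivative mult_ac)

lemma curvature_eq: "curvature c = k"
proof
  fix x
  have "curvature c x = k x * (((p x)\<^sup>2 + (q x)\<^sup>2) / (v x)\<^sup>2)"
    unfolding curvature_def arc_deriv_eq[OF tangent_deriv] using v_pos[of x]
    by (simp add: normal_eq inner_vec_def sum_2 power2_eq_square field_simps)
  then show "curvature c x = k x"
    unfolding v_sq[symmetric] using v_pos[of x] by simp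
qed

lemma arc_deriv_curvature_eq: "arc_deriv c (curvature c) = ks"
  using arc_deriv_eq[of k k'] k_deriv
  by (auto simp: curvature_eq ks_def has_real_derivative_iff_has_vector_derivative divide_inverse mult.commute)

lemma arc_deriv2_curvature_eq: "arc_deriv c (arc_deriv c (curvature c)) = kss"
  by (auto simp: arc_deriv_curvature_eq arc_deriv_def[of c ks] kss_def speed_eq divide_inverse mult.commute)

lemma isCont_speed_curvature: "isCont v x" "isCont k x" "isCont k' x" "isCont ks x"
proof -
  have *: "isCont p x" "isCont q x" "isCont p1 x" "isCont q1 x" "isCont p2 x" "isCont q2 x"
    using p q p1 q1 p2 q2 DERIV_isCont by blast+
  show v: "isCont v x" and "isCont k x" and "isCont ks x"
    using v_deriv k_deriv ks_deriv DERIV_isCont by blast+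
  show "isCont k' x"
    unfolding k'_def[abs_def] D_def E_def using * v v_pos[of x] by (auto intro!: continuous_intros)
qed

lemma c_coords: "((\<lambda>x. c x $ 1) has_real_derivative p x) (at x)" "((\<lambda>x. c x $ 2) has_real_derivative q x) (at x)"
  using c by (simp_all add: has_vector_derivative_vector_2_iff has_real_derivative_iff_has_vector_derivative)

lemma periodic_speed_curvature:
  "v (x + 1) = v x" "k (x + 1) = k x" "ks (x + 1) = ks x" "p (x + 1) = p x" "q (x + 1) = q x"
proof -
  have "p (x + 1) = p x" "q (x + 1) = q x" for x
    using DERIV_periodic[OF c_coords(1)] DERIV_periodic[OF c_coords(2)] by (simp_all add: periodic)
  moreover from this have "p1 (x + 1) = p1 x" "q1 (x + 1) = q1 x" for x
    using DERIV_periodic[OF p] DERIV_periodic[OF q] by simp_all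
  moreover from this have "p2 (x + 1) = p2 x" "q2 (x + 1) = q2 x" for x
    using DERIV_periodic[OF p1] DERIV_periodic[OF q1] by simp_all
  ultimately show "v (x + 1) = v x" "k (x + 1) = k x" "ks (x + 1) = ks x" "p (x + 1) = p x" "q (x + 1) = q x"
    by (simp_all add: ks_def k'_def k_def v_def D_def E_def)
qed

text \<open>Any primitive of \<open>k * v\<close> is a tangent angle up to a fixed rotation. In
  complex notation \<open>A - i B\<close> is \<open>exp (i \<theta>)\<close> times the conjugate of
  the unit tangent; both factors turn at rate \<open>k * v\<close> in opposite senses, so the
  product is constant.\<close>

lemma tangent_eq_rotated_cos_sin:
  assumes \<theta>: "\<And>x. (\<theta> has_real_derivative k x * v x) (at x)"
  shows "\<exists>A B. \<forall>x. cos (\<theta> x) = A * (p x / v x) + B * (q x / v x)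
                 \<and> sin (\<theta> x) = A * (q x / v x) - B * (p x / v x)"
proof -
  define A where "A x = p x / v x * cos (\<theta> x) + q x / v x * sin (\<theta> x)" for x
  define B where "B x = q x / v x * cos (\<theta> x) - p x / v x * sin (\<theta> x)" for x
  have "(A has_real_derivative 0) (at x)" "(B has_real_derivative 0) (at x)" for x
    unfolding A_def[abs_def] B_def[abs_def]
    by (rule derivative_eq_intros p_v_deriv q_v_deriv \<theta> refl | simp add: algebra_simps)+
  then have AB: "A x = A 0" "B x = B 0" for x
    using DERIV_isconst_all by blast+
  have "cos (\<theta> x) = A x * (p x / v x) + B x * (q x / v x)"
    "sin (\<theta> x) = A x * (q x / v x) - B x * (p x / v x)" for x
    unfolding A_def B_def using unit_tangent[of x] by algebra+
  then have "\<forall>x. cos (\<theta> x) = A 0 * (p x / v x) + B 0 * (q x / v x)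
           \<and> sin (\<theta> x) = A 0 * (q x / v x) - B 0 * (p x / v x)"
    by (metis AB)
  then show ?thesis by blast
qed

lemma rotation_index_eq: "rotation_index c = integral {0..1} (\<lambda>x. k x * v x) / (2 * pi)"
  by (simp add: rotation_index_def curvature_eq speed_eq)

text \<open>The unit tangent returns to itself after one period, hence so do the sine and cosine of
  a tangent angle; the total curvature is the increment of that angle.\<close>

lemma rotation_index_Ints: "rotation_index c \<in> \<int>"
proof -
  obtain \<theta> where \<theta>: "\<And>x. (\<theta> has_real_derivative k x * v x) (at x)"
    using continuous_imp_primitive[of "\<lambda>x. k x * v x"] isCont_speed_curvature by (auto intro!: continuous_intros)
  obtain A B where
    "\<And>x. cos (\<theta> x) = A * (p x / v x) + B * (q x / v x)"
    "\<And>x. sin (\<theta> x) = A * (q x / v x) - B * (p x / v x)"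
    using tangent_eq_rotated_cos_sin[OF \<theta>] by metis
  then have "sin (\<theta> (0 + 1)) = sin (\<theta> 0) \<and> cos (\<theta> (0 + 1)) = cos (\<theta> 0)"
    by (simp only: periodic_speed_curvature)
  then obtain n :: int where "\<theta> 1 = \<theta> 0 + 2 * pi * n"
    by (auto simp: sin_cos_eq_iff)
  moreover have "integral {0..1} (\<lambda>x. k x * v x) = \<theta> 1 - \<theta> 0"
    using has_integral_real_FTC[OF \<theta>, of 0 1] by (simp add: integral_unique)
  ultimately show ?thesis by (simp add: rotation_index_eq)
qed

lemma length_pos: "curve_length c > 0"
proof -
  obtain S where S: "\<And>x. (S has_real_derivative v x) (at x)"
    using continuous_imp_primitive[of v] isCont_speed_curvature by blast
  have "S 0 < S 1"
    using S v_pos by (intro DERIV_pos_imp_increasing[of 0 1 S]) force+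
  then show ?thesis
    using has_integral_real_FTC[OF S, of 0 1] by (simp add: integral_unique curve_length_def speed_eq)
qed

lemma energy_bound:
  assumes "rotation_index c = 0"
  shows "192 * pi\<^sup>2 \<le> curve_length c ^ 3 * integral {0..1} (\<lambda>x. (ks x)\<^sup>2 * v x)"
proof -
  define L where "L = curve_length c"
  have L: "L > 0" "L = integral {0..1} v"
    using length_pos by (simp_all add: L_def curve_length_def speed_eq)
  have mean_k: "integral {0..1} (\<lambda>x. k x * v x) = 0"
    using assms by (simp add: rotation_index_eq)
  obtain \<theta>0 where \<theta>0: "\<And>x. (\<theta>0 has_real_derivative k x * v x) (at x)"
    using continuous_imp_primitive[of "\<lambda>x. k x * v x"] isCont_speed_curvature by (auto intro!: continuous_intros)
  define m where "m = integral {0..1} (\<lambda>x. \<theta>0 x * v x) / L"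
  define \<theta> where "\<theta> x = \<theta>0 x - m" for x
  have \<theta>: "(\<theta> has_real_derivative k x * v x) (at x)" for x
    unfolding \<theta>_def[abs_def] by (auto intro!: derivative_eq_intros \<theta>0)
  have \<theta>_cont: "isCont \<theta>0 x" "isCont \<theta> x" for x using \<theta>0 \<theta> DERIV_isCont by blast+
  \<comment> \<open>This is where rotation index zero enters: the tangent angle closes up and
    Wirtinger's inequality applies to it.\<close>
  have \<theta>_per: "\<theta> (x + 1) = \<theta> x" for x
    using primitive_periodic[OF \<theta>, of x] by (simp add: periodic_speed_curvature mean_k)
  have v_int: "(v has_integral L) {0..1}"
    unfolding L(2) by (intro integrable_integral integrable_continuous_real continuous_at_imp_continuous_on) (simp add: isCont_speed_curvature)
  have mean_\<theta>: "integral {0..1} (\<lambda>x. \<theta> x * v x) = 0"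
  proof -
    have "(\<lambda>x. \<theta>0 x * v x) integrable_on {0..1}"
      by (intro integrable_continuous_real continuous_at_imp_continuous_on) (auto intro!: continuous_intros isCont_speed_curvature \<theta>_cont)
    then have "((\<lambda>x. \<theta>0 x * v x - m * v x) has_integral (integral {0..1} (\<lambda>x. \<theta>0 x * v x) - m * L)) {0..1}"
      by (intro has_integral_diff has_integral_mult_right v_int integrable_integral)
    then show ?thesis using L(1)
      by (simp add: \<theta>_def m_def left_diff_distrib integral_unique)
  qed
  have \<theta>_sq: "2 * L \<le> integral {0..1} (\<lambda>x. (\<theta> x)\<^sup>2 * v x)"
  proof -
    obtain A B where AB: "\<And>x. cos (\<theta> x) = A * (p x / v x) + B * (q x / v x)"
      "\<And>x. sin (\<theta> x) = A * (q x / v x) - B * (p x / v x)"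
      using tangent_eq_rotated_cos_sin[OF \<theta>] by metis
    \<comment> \<open>\<open>cos \<theta> * v\<close> is a constant combination of \<open>p\<close>
      and \<open>q\<close>, each of which integrates to zero on a closed curve; the unknown rotation
      does no harm.\<close>
    have "c 1 = c 0" using periodic[of 0] by simp
    then have "(p has_integral 0) {0..1}" "(q has_integral 0) {0..1}"
      using has_integral_real_FTC[OF c_coords(1), of 0 1] has_integral_real_FTC[OF c_coords(2), of 0 1] by simp_all
    then have "((\<lambda>x. A * p x + B * q x) has_integral (A * 0 + B * 0)) {0..1}"
      by (intro has_integral_add has_integral_mult_right)
    moreover have "A * p x + B * q x = cos (\<theta> x) * v x" for x
      using v_pos[of x] by (simp add: AB(1) field_simps)
    ultimately have cos_int: "((\<lambda>x. cos (\<theta> x) * v x) has_integral 0) {0..1}" by simp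
    have sq_int: "(\<lambda>x. (\<theta> x)\<^sup>2 * v x) integrable_on {0..1}"
      by (intro integrable_continuous_real continuous_at_imp_continuous_on) (auto intro!: continuous_intros isCont_speed_curvature \<theta>_cont)
    have "((\<lambda>x. (\<theta> x)\<^sup>2 * v x - 2 * v x + 2 * (cos (\<theta> x) * v x)) has_integral
        (integral {0..1} (\<lambda>x. (\<theta> x)\<^sup>2 * v x) - 2 * L + 2 * 0)) {0..1}"
      by (intro has_integral_add has_integral_diff has_integral_mult_right v_int cos_int integrable_integral sq_int)
    then have "0 \<le> integral {0..1} (\<lambda>x. (\<theta> x)\<^sup>2 * v x) - 2 * L + 2 * 0"
    proof (rule has_integral_nonneg)
      fix x
      have "0 \<le> ((\<theta> x)\<^sup>2 - 2 + 2 * cos (\<theta> x)) * v x"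
        by (intro mult_nonneg_nonneg cos_ge_quadratic less_imp_le[OF v_pos])
      then show "0 \<le> (\<theta> x)\<^sup>2 * v x - 2 * v x + 2 * (cos (\<theta> x) * v x)"
        by (simp add: algebra_simps)
    qed
    then show ?thesis by simp
  qed
  define \<omega> where "\<omega> = (2 * pi / L)\<^sup>2"
  \<comment> \<open>Wirtinger is used twice: for the angle, whose parameter derivative is
    \<open>k * v\<close>, and for \<open>k\<close>, whose weighted mean is the vanishing total
    curvature.\<close>
  have "\<omega> * integral {0..1} (\<lambda>x. (\<theta> x)\<^sup>2 * v x) \<le> integral {0..1} (\<lambda>x. (k x * v x)\<^sup>2 / v x)"
    unfolding \<omega>_def L(2)
    by (rule weighted_Wirtinger[OF \<theta> \<theta>_per v_pos periodic_speed_curvature(1) isCont_speed_curvature(1) _ mean_\<theta>])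
       (auto intro!: continuous_intros isCont_speed_curvature)
  moreover have "(k x * v x)\<^sup>2 / v x = (k x)\<^sup>2 * v x" for x
    using v_pos[of x] by (simp add: power2_eq_square)
  moreover have "\<omega> * integral {0..1} (\<lambda>x. (k x)\<^sup>2 * v x) \<le> integral {0..1} (\<lambda>x. (k' x)\<^sup>2 / v x)"
    unfolding \<omega>_def L(2)
    by (rule weighted_Wirtinger[OF k_deriv periodic_speed_curvature(2) v_pos periodic_speed_curvature(1) isCont_speed_curvature(1,3) mean_k])
  moreover have "(k' x)\<^sup>2 / v x = (ks x)\<^sup>2 * v x" for x
    using v_pos[of x] by (simp add: ks_def power2_eq_square)
  ultimately have *: "\<omega> * integral {0..1} (\<lambda>x. (\<theta> x)\<^sup>2 * v x) \<le> integral {0..1} (\<lambda>x. (k x)\<^sup>2 * v x)"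
    "\<omega> * integral {0..1} (\<lambda>x. (k x)\<^sup>2 * v x) \<le> integral {0..1} (\<lambda>x. (ks x)\<^sup>2 * v x)"
    by simp_all
  have \<omega>0: "\<omega> \<ge> 0" by (simp add: \<omega>_def)
  have "\<omega> * (\<omega> * (2 * L)) \<le> \<omega> * (\<omega> * integral {0..1} (\<lambda>x. (\<theta> x)\<^sup>2 * v x))"
    using \<theta>_sq \<omega>0 by (intro mult_left_mono)
  also have "\<dots> \<le> \<omega> * integral {0..1} (\<lambda>x. (k x)\<^sup>2 * v x)"
    using * \<omega>0 by (intro mult_left_mono)
  also note *(2)
  finally have "L ^ 3 * (\<omega> * (\<omega> * (2 * L))) \<le> L ^ 3 * integral {0..1} (\<lambda>x. (ks x)\<^sup>2 * v x)"
    using L by (intro mult_left_mono) auto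
  moreover have "L ^ 3 * (\<omega> * (\<omega> * (2 * L))) = 32 * pi\<^sup>2 * pi\<^sup>2"
    using L(1) by (simp add: \<omega>_def field_simps eval_nat_numeral)
  \<comment> \<open>The factor 6 is 192 / 32; the bound \<open>pi > 3\<close> gives even 9.\<close>
  moreover have "6 \<le> pi\<^sup>2"
    using power_mono[of 3 pi 2] pi_gt3 by simp
  then have "32 * pi\<^sup>2 * 6 \<le> 32 * pi\<^sup>2 * pi\<^sup>2"
    by (intro mult_left_mono) auto
  ultimately show ?thesis unfolding L_def[symmetric] by linarith
qed

text \<open>Integration by parts on the closed curve: the derivative of \<open>k * ks\<close>
  integrates to zero over a period.\<close>

lemma kss_integral:
  "((\<lambda>x. kss x * k x * v x) has_integral - integral {0..1} (\<lambda>x. (ks x)\<^sup>2 * v x)) {0..1}"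
proof -
  have "((\<lambda>x. k x * ks x) has_real_derivative (ks x)\<^sup>2 * v x + kss x * k x * v x) (at x)" for x
  proof -
    have "k' x = ks x * v x" using v_pos[of x] by (simp add: ks_def)
    with DERIV_mult[OF k_deriv ks_deriv, of x] show ?thesis
      by (simp add: power2_eq_square mult_ac)
  qed
  from has_integral_real_FTC[OF this, of 0 1]
  have "((\<lambda>x. (ks x)\<^sup>2 * v x + kss x * k x * v x) has_integral 0) {0..1}"
    using periodic_speed_curvature(2,3)[of 0] by simp
  moreover have "(\<lambda>x. (ks x)\<^sup>2 * v x) integrable_on {0..1}"
    by (intro integrable_continuous_real continuous_at_imp_continuous_on) (auto intro!: continuous_intros isCont_speed_curvature)
  ultimately have "((\<lambda>x. ((ks x)\<^sup>2 * v x + kss x * k x * v x) - (ks x)\<^sup>2 * v x) has_integral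
     (0 - integral {0..1} (\<lambda>x. (ks x)\<^sup>2 * v x))) {0..1}"
    by (intro has_integral_diff integrable_integral)
  then show ?thesis by simp
qed

text \<open>\<open>F\<close> is the velocity of the flow. Being normal, it is orthogonal to the unit
  tangent; differentiating this relation moves the derivative onto the tangent, and the Frenet
  equations finish. The result is the rate of change of the speed.\<close>

lemma normal_variation:
  assumes F: "\<And>y. F y = - (kss y *\<^sub>R unit_normal c y)"
    and F': "(F has_vector_derivative F') (at x)"
  shows "F' \<bullet> vector [p x / v x, q x / v x] = kss x * k x * v x"
proof -
  have F1: "((\<lambda>x. F x $ 1) has_real_derivative F' $ 1) (at x)"
    and F2: "((\<lambda>x. F x $ 2) has_real_derivative F' $ 2) (at x)"
    using F' by (simp_all add: has_vector_derivative_vector_2_iff has_real_derivative_iff_has_vector_derivative)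
  define a b \<kappa> where "a x = p x / v x" and "b x = q x / v x" and "\<kappa> x = k x * v x" for x
  have "((\<lambda>x. F x $ 1 * a x + F x $ 2 * b x) has_real_derivative
     (F' $ 1 * a x + (- b x * \<kappa> x) * F x $ 1) + (F' $ 2 * b x + (a x * \<kappa> x) * F x $ 2)) (at x)"
    unfolding a_def[abs_def] b_def[abs_def] \<kappa>_def by (intro DERIV_add DERIV_mult F1 F2 p_v_deriv q_v_deriv)
  moreover have F_eq: "F y $ 1 = kss y * b y" "F y $ 2 = - kss y * a y" for y
    by (simp_all add: F normal_eq a_def b_def)
  then have "(\<lambda>x. F x $ 1 * a x + F x $ 2 * b x) = (\<lambda>x. 0)"
    by (simp add: fun_eq_iff)
  ultimately have "((\<lambda>x. 0) has_real_derivative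
     (F' $ 1 * a x + (- b x * \<kappa> x) * F x $ 1) + (F' $ 2 * b x + (a x * \<kappa> x) * F x $ 2)) (at x)"
    by simp
  from DERIV_unique[OF this DERIV_const]
  have "(F' $ 1 * a x + (- b x * \<kappa> x) * (kss x * b x)) + (F' $ 2 * b x + (a x * \<kappa> x) * (- kss x * a x)) = 0"
    unfolding F_eq .
  moreover have "(a x)\<^sup>2 + (b x)\<^sup>2 = 1"
    unfolding a_def b_def by (rule unit_tangent)
  ultimately have "F' $ 1 * a x + F' $ 2 * b x = kss x * \<kappa> x"
    by algebra
  then show ?thesis by (simp add: inner_vec_def sum_2 a_def b_def \<kappa>_def)
qed

end

section \<open>The flow\<close>

lemma smooth_on_continuous: "smooth_on S f \<Longrightarrow> continuous_on S f"
  unfolding smooth_on_def by (metis Cn_on.simps(1))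

lemma smooth_on_has_derivative:
  "smooth_on S f \<Longrightarrow> x \<in> S \<Longrightarrow> (f has_derivative frechet_derivative f (at x within S)) (at x within S)"
  unfolding smooth_on_def by (metis Cn_on.simps(2) differentiable_on_def frechet_derivative_works)

lemma smooth_on_frechet_derivative:
  "smooth_on S f \<Longrightarrow> smooth_on S (\<lambda>x. frechet_derivative f (at x within S) v)"
  unfolding smooth_on_def by (metis Cn_on.simps(2))

lemma smooth_on_UNIV_has_vector_derivative:
  fixes f :: "real \<Rightarrow> 'b::real_normed_vector"
  assumes "smooth_on UNIV f"
  shows "(f has_vector_derivative vector_derivative f (at x)) (at x)"
    and "smooth_on UNIV (\<lambda>x. vector_derivative f (at x))"
proof -
  have diff: "f differentiable (at x)" for x
    using smooth_on_has_derivative[OF assms, of x] by (auto intro: differentiableI)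
  then show "(f has_vector_derivative vector_derivative f (at x)) (at x)"
    by (simp add: vector_derivative_works)
  have "smooth_on UNIV (\<lambda>x. frechet_derivative f (at x) 1)"
    using smooth_on_frechet_derivative[OF assms] .
  then show "smooth_on UNIV (\<lambda>x. vector_derivative f (at x))"
    by (simp add: frechet_derivative_eq_vector_derivative[OF diff])
qed

lemma closed_immersed_curve_imp_plane_curve:
  assumes "closed_immersed_curve c"
  defines "c1 \<equiv> \<lambda>x. vector_derivative c (at x)"
  defines "c2 \<equiv> \<lambda>x. vector_derivative c1 (at x)"
  defines "c3 \<equiv> \<lambda>x. vector_derivative c2 (at x)"
  defines "c4 \<equiv> \<lambda>x. vector_derivative c3 (at x)"
  shows "plane_curve c (\<lambda>x. c1 x $ 1) (\<lambda>x. c1 x $ 2) (\<lambda>x. c2 x $ 1) (\<lambda>x. c2 x $ 2)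
           (\<lambda>x. c3 x $ 1) (\<lambda>x. c3 x $ 2) (\<lambda>x. c4 x $ 1) (\<lambda>x. c4 x $ 2)"
proof -
  have c: "smooth_on UNIV c" "c (x + 1) = c x" "c1 x \<noteq> 0" for x
    using assms(1) by (auto simp: closed_immersed_curve_def c1_def)
  have sm: "smooth_on UNIV c1" "smooth_on UNIV c2" "smooth_on UNIV c3"
    unfolding c3_def c2_def c1_def
    by (intro smooth_on_UNIV_has_vector_derivative(2) c(1))+
  have d: "(c has_vector_derivative c1 x) (at x)" "(c1 has_vector_derivative c2 x) (at x)"
    "(c2 has_vector_derivative c3 x) (at x)" "(c3 has_vector_derivative c4 x) (at x)" for x
    using smooth_on_UNIV_has_vector_derivative(1) c(1) sm by (auto simp: c1_def c2_def c3_def c4_def)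
  have "0 < (c1 x $ 1)\<^sup>2 + (c1 x $ 2)\<^sup>2" for x
    using c(3)[of x] by (auto simp: vec_eq_iff forall_2 sum_power2_gt_zero_iff)
  then show ?thesis
    using d c(2)
    by unfold_locales
       (simp_all add: has_vector_derivative_vector_2_iff has_real_derivative_iff_has_vector_derivative)
qed

text \<open>Slices in the first variable are full lines, so this derivative is two-sided even at an
  endpoint of \<open>I\<close>; in the second variable it can only be taken within
  \<open>I\<close>.\<close>

lemma has_vector_derivative_fst_slice:
  fixes f :: "real \<times> real \<Rightarrow> 'b::real_normed_vector"
  assumes "(f has_derivative f') (at (x, t) within UNIV \<times> I)" "t \<in> I"
  shows "((\<lambda>x. f (x, t)) has_vector_derivative f' (1, 0)) (at x)"
proof -
  have "(f has_derivative f') (at (x, t) within range (\<lambda>x. (x, t)))"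
    by (rule has_derivative_subset[OF assms(1)]) (simp add: image_subset_iff assms(2))
  moreover have "((\<lambda>x. (x, t)) has_derivative (\<lambda>h. (h, 0))) (at x)"
    by (auto intro!: derivative_eq_intros)
  ultimately have "((\<lambda>x. f (x, t)) has_derivative (\<lambda>h. f' (h, 0))) (at x)"
    by (rule has_derivative_in_compose[rotated])
  moreover have "(\<lambda>h. f' (h, 0)) = (\<lambda>h. h *\<^sub>R f' (1, 0))"
  proof
    fix h :: real
    have "(h, 0 :: real) = h *\<^sub>R (1, 0)" by simp
    then show "f' (h, 0) = h *\<^sub>R f' (1, 0)"
      by (simp only: linear_scale[OF has_derivative_linear[OF assms(1)]])
  qed
  ultimately show ?thesis by (simp only: has_vector_derivative_def)
qed

lemma has_vector_derivative_snd_slice: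
  fixes f :: "real \<times> real \<Rightarrow> 'b::real_normed_vector"
  assumes "(f has_derivative f') (at (x, t) within UNIV \<times> I)" "t \<in> I"
  shows "((\<lambda>t. f (x, t)) has_vector_derivative f' (0, 1)) (at t within I)"
proof -
  have "(f has_derivative f') (at (x, t) within (\<lambda>t. (x, t)) ` I)"
    by (rule has_derivative_subset[OF assms(1)]) (simp add: image_subset_iff)
  moreover have "((\<lambda>t. (x, t)) has_derivative (\<lambda>h. (0, h))) (at t within I)"
    by (auto intro!: derivative_eq_intros)
  ultimately have "((\<lambda>t. f (x, t)) has_derivative (\<lambda>h. f' (0, h))) (at t within I)"
    by (rule has_derivative_in_compose[rotated])
  moreover have "(\<lambda>h. f' (0, h)) = (\<lambda>h. h *\<^sub>R f' (0, 1))"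
  proof
    fix h :: real
    have "(0 :: real, h) = h *\<^sub>R (0, 1)" by simp
    then show "f' (0, h) = h *\<^sub>R f' (0, 1)"
      by (simp only: linear_scale[OF has_derivative_linear[OF assms(1)]])
  qed
  ultimately show ?thesis by (simp only: has_vector_derivative_def)
qed

text \<open>Symmetry of mixed partials, from \<open>f(x,t) = f(x,0) + \<integral>\<^sub>0\<^sup>t f\<^sub>t(x,r) dr\<close>
  differentiated under the integral.\<close>

lemma mixed_partials:
  fixes f fx ft ftx :: "real \<times> real \<Rightarrow> 'b::euclidean_space"
  assumes fx: "\<And>x t. t \<in> {0..<T} \<Longrightarrow> ((\<lambda>x. f (x, t)) has_vector_derivative fx (x, t)) (at x)"
    and ft: "\<And>x t. t \<in> {0..<T} \<Longrightarrow> ((\<lambda>t. f (x, t)) has_vector_derivative ft (x, t)) (at t within {0..<T})"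
    and ftx: "\<And>x t. t \<in> {0..<T} \<Longrightarrow> ((\<lambda>x. ft (x, t)) has_vector_derivative ftx (x, t)) (at x)"
    and cont: "continuous_on (UNIV \<times> {0..<T}) ft" "continuous_on (UNIV \<times> {0..<T}) ftx"
    and t: "t \<in> {0<..<T}"
  shows "((\<lambda>t. fx (x, t)) has_vector_derivative ftx (x, t)) (at t)"
proof -
  \<comment> \<open>Choosing \<open>b\<close> strictly between \<open>t\<close> and \<open>T\<close>
    puts \<open>t\<close> in the interior of \<open>{0..b}\<close>, which makes the final derivative
    two-sided.\<close>
  obtain b where b: "t < b" "b < T" using t dense[of t T] by auto
  have fx_eq: "fx (x, s) = fx (x, 0) + integral {0..s} (\<lambda>r. ftx (x, r))" if s: "s \<in> {0..b}" for s
  proof -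
    have sT: "0 \<in> {0..<T}" "s \<in> {0..<T}" "{0..s} \<subseteq> {0..<T}"
      using s b t by (simp_all add: subset_iff)
    have FTC: "((\<lambda>r. ft (y, r)) has_integral (f (y, s) - f (y, 0))) {0..s}" for y
    proof (rule fundamental_theorem_of_calculus)
      fix r assume "r \<in> {0..s}"
      then show "((\<lambda>r. f (y, r)) has_vector_derivative ft (y, r)) (at r within {0..s})"
        using sT(3) by (intro has_vector_derivative_within_subset[OF ft]) auto
    qed (use s in auto)
    have eq: "f (y, s) = f (y, 0) + integral {0..s} (\<lambda>r. ft (y, r))" for y
      using integral_unique[OF FTC[of y]] by (simp add: algebra_simps)
    have int: "(\<lambda>r. ft (y, r)) integrable_on {0..s}" for y
      by (rule has_integral_integrable[OF FTC])
    have "((\<lambda>y. integral (cbox 0 s) (\<lambda>r. ft (y, r))) has_vector_derivative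
        integral (cbox 0 s) (\<lambda>r. ftx (x, r))) (at x within UNIV)"
    proof (rule leibniz_rule_vector_derivative)
      show "continuous_on (UNIV \<times> cbox 0 s) (\<lambda>(x, r). ftx (x, r))"
        unfolding case_prod_unfold prod.collapse
        by (rule continuous_on_subset[OF cont(2)]) (use sT(3) in auto)
      fix y r :: real assume "r \<in> cbox 0 s"
      then show "((\<lambda>y. ft (y, r)) has_vector_derivative ftx (y, r)) (at y within UNIV)"
        using sT(3) by (intro ftx) auto
    qed (use int in simp_all)
    then have "((\<lambda>y. f (y, 0) + integral {0..s} (\<lambda>r. ft (y, r))) has_vector_derivative
        fx (x, 0) + integral {0..s} (\<lambda>r. ftx (x, r))) (at x)"
      using sT by (intro has_vector_derivative_add fx) auto
    then have "((\<lambda>y. f (y, s)) has_vector_derivative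
        fx (x, 0) + integral {0..s} (\<lambda>r. ftx (x, r))) (at x)"
      using eq by simp
    then show ?thesis by (rule vector_derivative_unique_at[OF fx[OF sT(2)]])
  qed
  have "continuous_on {0..b} (\<lambda>r. ftx (x, r))"
    using b by (intro continuous_on_compose2[OF cont(2)] continuous_intros) auto
  then have "((\<lambda>s. integral {0..s} (\<lambda>r. ftx (x, r))) has_vector_derivative ftx (x, t)) (at t within {0..b})"
    by (rule integral_has_vector_derivative) (use t b in auto)
  moreover have "at t within {0..b} = at t"
    by (rule at_within_interior) (use t b in auto)
  ultimately have "((\<lambda>s. fx (x, 0) + integral {0..s} (\<lambda>r. ftx (x, r))) has_vector_derivative 0 + ftx (x, t)) (at t)"
    by (intro has_vector_derivative_add has_vector_derivative_const) simp
  then have "((\<lambda>s. fx (x, 0) + integral {0..s} (\<lambda>r. ftx (x, r))) has_vector_derivative ftx (x, t)) (at t)"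
    by simp
  then show ?thesis
    by (rule has_vector_derivative_transform_within_open[where S="{0<..<b}"])
       (use t b in \<open>auto intro: fx_eq[symmetric]\<close>)
qed

text \<open>Distinct integers are at least 1 apart, so the range is discrete.\<close>

lemma continuous_on_Ints_valued_constant:
  fixes f :: "real \<Rightarrow> real"
  assumes "connected S" "continuous_on S f" "\<And>x. x \<in> S \<Longrightarrow> f x \<in> \<int>" "a \<in> S" "b \<in> S"
  shows "f a = f b"
proof -
  have "f constant_on S"
  proof (rule continuous_discrete_range_constant[OF assms(1,2)])
    fix x assume "x \<in> S"
    then have "\<forall>y. y \<in> S \<and> f y \<noteq> f x \<longrightarrow> 1 \<le> norm (f y - f x)"
      using assms(3) Ints_nonzero_abs_ge1[OF Ints_diff] by auto
    then show "\<exists>e>0. \<forall>y. y \<in> S \<and> f y \<noteq> f x \<longrightarrow> e \<le> norm (f y - f x)"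
      using zero_less_one by blast
  qed
  then show ?thesis using assms(4,5) by (auto simp: constant_on_def)
qed

section \<open>Evolution of rotation index and length along a flow\<close>

locale flow_of_curves =
  fixes T :: real and \<gamma> :: "real \<Rightarrow> real \<Rightarrow> real^2"
  assumes flow: "curve_diffusion_flow T \<gamma>"
begin

text \<open>The flow as a map on space-time, space variable first. All partial derivatives are taken
  within the half-open strip, hence one-sided in time at 0.\<close>

definition G where "G = (\<lambda>(x, t). \<gamma> t x)"
definition Gx where "Gx z = frechet_derivative G (at z within UNIV \<times> {0..<T}) (1, 0)"
definition Gt where "Gt z = frechet_derivative G (at z within UNIV \<times> {0..<T}) (0, 1)"
definition Gxx where "Gxx z = frechet_derivative Gx (at z within UNIV \<times> {0..<T}) (1, 0)"
definition Gtx where "Gtx z = frechet_derivative Gt (at z within UNIV \<times> {0..<T}) (1, 0)"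

lemma smooth_partials:
  "smooth_on (UNIV \<times> {0..<T}) G" "smooth_on (UNIV \<times> {0..<T}) Gx" "smooth_on (UNIV \<times> {0..<T}) Gt"
  "smooth_on (UNIV \<times> {0..<T}) Gxx" "smooth_on (UNIV \<times> {0..<T}) Gtx"
proof -
  show G: "smooth_on (UNIV \<times> {0..<T}) G"
    using flow by (simp add: curve_diffusion_flow_def G_def)
  show Gx: "smooth_on (UNIV \<times> {0..<T}) Gx" and Gt: "smooth_on (UNIV \<times> {0..<T}) Gt"
    unfolding Gx_def[abs_def] Gt_def[abs_def] by (rule smooth_on_frechet_derivative[OF G])+
  show "smooth_on (UNIV \<times> {0..<T}) Gxx" "smooth_on (UNIV \<times> {0..<T}) Gtx"
    unfolding Gxx_def[abs_def] Gtx_def[abs_def]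
    by (rule smooth_on_frechet_derivative[OF Gx] smooth_on_frechet_derivative[OF Gt])+
qed

lemma x_derivs:
  assumes "t \<in> {0..<T}"
  shows "(\<gamma> t has_vector_derivative Gx (x, t)) (at x)"
    "((\<lambda>x. Gx (x, t)) has_vector_derivative Gxx (x, t)) (at x)"
    "((\<lambda>x. Gt (x, t)) has_vector_derivative Gtx (x, t)) (at x)"
proof -
  have "((\<lambda>x. G (x, t)) has_vector_derivative Gx (x, t)) (at x)"
    unfolding Gx_def by (rule has_vector_derivative_fst_slice[OF smooth_on_has_derivative[OF smooth_partials(1)]]) (use assms in auto)
  then show "(\<gamma> t has_vector_derivative Gx (x, t)) (at x)" by (simp add: G_def)
  show "((\<lambda>x. Gx (x, t)) has_vector_derivative Gxx (x, t)) (at x)"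
    unfolding Gxx_def by (rule has_vector_derivative_fst_slice[OF smooth_on_has_derivative[OF smooth_partials(2)]]) (use assms in auto)
  show "((\<lambda>x. Gt (x, t)) has_vector_derivative Gtx (x, t)) (at x)"
    unfolding Gtx_def by (rule has_vector_derivative_fst_slice[OF smooth_on_has_derivative[OF smooth_partials(3)]]) (use assms in auto)
qed

lemma t_deriv:
  assumes "t \<in> {0..<T}"
  shows "((\<lambda>t. G (x, t)) has_vector_derivative Gt (x, t)) (at t within {0..<T})"
  unfolding Gt_def by (rule has_vector_derivative_snd_slice[OF smooth_on_has_derivative[OF smooth_partials(1)]]) (use assms in auto)

lemma Gx_t_deriv:
  assumes "t \<in> {0<..<T}"
  shows "((\<lambda>t. Gx (x, t)) has_vector_derivative Gtx (x, t)) (at t)"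
  by (rule mixed_partials[of T G Gx Gt Gtx])
     (use assms t_deriv x_derivs smooth_partials in \<open>auto simp: G_def intro: smooth_on_continuous\<close>)

lemma closed_immersed: "t \<in> {0..<T} \<Longrightarrow> closed_immersed_curve (\<gamma> t)"
  using flow by (simp add: curve_diffusion_flow_def)

lemma Gx_eq: "t \<in> {0..<T} \<Longrightarrow> vector_derivative (\<gamma> t) (at x) = Gx (x, t)"
  by (intro vector_derivative_at x_derivs)

lemma Gx_nz: "t \<in> {0..<T} \<Longrightarrow> Gx (x, t) \<noteq> 0"
  using closed_immersed[of t] Gx_eq[of t x] by (metis closed_immersed_curve_def)

lemma speed_Gx: "t \<in> {0..<T} \<Longrightarrow> speed (\<gamma> t) = (\<lambda>x. norm (Gx (x, t)))"
  by (simp add: fun_eq_iff speed_def Gx_eq)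

lemma continuous_on_partials: "continuous_on X h \<Longrightarrow> h ` X \<subseteq> UNIV \<times> {0..<T} \<Longrightarrow> continuous_on X (\<lambda>z. Gx (h z))"
  "continuous_on X h \<Longrightarrow> h ` X \<subseteq> UNIV \<times> {0..<T} \<Longrightarrow> continuous_on X (\<lambda>z. Gxx (h z))"
  "continuous_on X h \<Longrightarrow> h ` X \<subseteq> UNIV \<times> {0..<T} \<Longrightarrow> continuous_on X (\<lambda>z. Gtx (h z))"
  by (rule continuous_on_compose2[OF smooth_on_continuous[OF smooth_partials(2)]]
      continuous_on_compose2[OF smooth_on_continuous[OF smooth_partials(4)]]
      continuous_on_compose2[OF smooth_on_continuous[OF smooth_partials(5)]]; assumption)+

text \<open>Time 0 is included on purpose: the length is differentiated only at positive times, and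
  continuity carries the estimate back to the initial curve.\<close>

lemma length_continuous: "continuous_on {0..<T} (\<lambda>t. curve_length (\<gamma> t))"
proof -
  have "continuous_on {0..<T} (\<lambda>t. integral (cbox 0 1) (\<lambda>x. norm (Gx (x, t))))"
    by (rule integral_continuous_on_param)
       (auto simp: case_prod_unfold intro!: continuous_intros continuous_on_partials)
  then show ?thesis
    by (rule continuous_on_eq) (simp add: curve_length_def speed_Gx)
qed

text \<open>Since \<open>k * v = D / v\<^sup>2\<close>, the integrand involves only
  \<open>Gx\<close> and \<open>Gxx\<close>, which are jointly continuous; this makes the index
  continuous in time.\<close>

lemma rotation_index_Gx:
  assumes t: "t \<in> {0..<T}"
  shows "rotation_index (\<gamma> t) = integral (cbox 0 1)
     (\<lambda>x. (Gx (x, t) $ 1 * Gxx (x, t) $ 2 - Gx (x, t) $ 2 * Gxx (x, t) $ 1) / (norm (Gx (x, t)))\<^sup>2) / (2 * pi)"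
proof -
  let ?c1 = "\<lambda>x. vector_derivative (\<gamma> t) (at x)"
  let ?c2 = "\<lambda>x. vector_derivative ?c1 (at x)"
  let ?c3 = "\<lambda>x. vector_derivative ?c2 (at x)"
  let ?c4 = "\<lambda>x. vector_derivative ?c3 (at x)"
  interpret plane_curve "\<gamma> t" "\<lambda>x. ?c1 x $ 1" "\<lambda>x. ?c1 x $ 2" "\<lambda>x. ?c2 x $ 1" "\<lambda>x. ?c2 x $ 2"
    "\<lambda>x. ?c3 x $ 1" "\<lambda>x. ?c3 x $ 2" "\<lambda>x. ?c4 x $ 1" "\<lambda>x. ?c4 x $ 2"
    by (rule closed_immersed_curve_imp_plane_curve[OF closed_immersed[OF t]])
  have "v x = norm (Gx (x, t))" for x
    using fun_cong[OF speed_Gx[OF t], of x] fun_cong[OF speed_eq, of x] by simp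
  moreover have "D x = Gx (x, t) $ 1 * Gxx (x, t) $ 2 - Gx (x, t) $ 2 * Gxx (x, t) $ 1" for x
    unfolding D_def by (simp add: Gx_eq[OF t] vector_derivative_at[OF x_derivs(2)[OF t]])
  moreover have "k x * v x = D x / (v x)\<^sup>2" for x
    using v_pos[of x] by (simp add: k_def field_simps eval_nat_numeral)
  ultimately show ?thesis
    unfolding rotation_index_eq
    by simp
qed

lemma rotation_index_preserved:
  assumes t: "t \<in> {0..<T}"
  shows "rotation_index (\<gamma> t) = rotation_index (\<gamma> 0)"
proof (rule continuous_on_Ints_valued_constant[of "{0..<T}" "\<lambda>t. rotation_index (\<gamma> t)"])
  have "continuous_on {0..<T} (\<lambda>t. integral (cbox 0 1)
     (\<lambda>x. (Gx (x, t) $ 1 * Gxx (x, t) $ 2 - Gx (x, t) $ 2 * Gxx (x, t) $ 1) / (norm (Gx (x, t)))\<^sup>2) / (2 * pi))"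
    by (intro continuous_intros integral_continuous_on_param)
       (auto simp: case_prod_unfold Gx_nz intro!: continuous_intros continuous_on_partials)
  then show "continuous_on {0..<T} (\<lambda>t. rotation_index (\<gamma> t))"
    by (rule continuous_on_eq) (simp only: rotation_index_Gx)
  show "rotation_index (\<gamma> s) \<in> \<int>" if "s \<in> {0..<T}" for s
    by (rule plane_curve.rotation_index_Ints[OF closed_immersed_curve_imp_plane_curve[OF closed_immersed[OF that]]])
qed (use t in auto)

text \<open>First variation of length. Differentiation under the integral gives the rate of change
  of speed, namely \<open>kss * k * v\<close>, and integration by parts turns its integral into
  minus the energy \<open>J\<close>.\<close>

lemma length_deriv:
  assumes t: "t \<in> {0<..<T}" and rot: "rotation_index (\<gamma> t) = 0"
  obtains J where "((\<lambda>t. curve_length (\<gamma> t)) has_real_derivative - J) (at t)"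
    "192 * pi\<^sup>2 \<le> curve_length (\<gamma> t) ^ 3 * J"
proof -
  have t': "t \<in> {0..<T}" using t by auto
  let ?c1 = "\<lambda>x. vector_derivative (\<gamma> t) (at x)"
  let ?c2 = "\<lambda>x. vector_derivative ?c1 (at x)"
  let ?c3 = "\<lambda>x. vector_derivative ?c2 (at x)"
  let ?c4 = "\<lambda>x. vector_derivative ?c3 (at x)"
  interpret plane_curve "\<gamma> t" "\<lambda>x. ?c1 x $ 1" "\<lambda>x. ?c1 x $ 2" "\<lambda>x. ?c2 x $ 1" "\<lambda>x. ?c2 x $ 2"
    "\<lambda>x. ?c3 x $ 1" "\<lambda>x. ?c3 x $ 2" "\<lambda>x. ?c4 x $ 1" "\<lambda>x. ?c4 x $ 2"
    by (rule closed_immersed_curve_imp_plane_curve[OF closed_immersed[OF t']])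
  define J where "J = integral {0..1} (\<lambda>x. (ks x)\<^sup>2 * v x)"
  have "((\<lambda>t. integral (cbox 0 1) (\<lambda>x. norm (Gx (x, t)))) has_real_derivative
      integral (cbox 0 1) (\<lambda>x. Gtx (x, t) \<bullet> sgn (Gx (x, t)))) (at t within {0<..<T})"
  proof (rule leibniz_rule_field_derivative)
    fix s x :: real assume s: "s \<in> {0<..<T}"
    have "((\<lambda>s. norm (Gx (x, s))) has_derivative (\<lambda>h. (h *\<^sub>R Gtx (x, s)) \<bullet> sgn (Gx (x, s)))) (at s)"
      by (rule has_derivative_compose[OF Gx_t_deriv[OF s, unfolded has_vector_derivative_def]
            has_derivative_norm[OF Gx_nz]]) (use s in auto)
    then have "((\<lambda>s. norm (Gx (x, s))) has_real_derivative (Gtx (x, s) \<bullet> sgn (Gx (x, s)))) (at s)"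
      by (rule has_derivative_imp_has_field_derivative) simp
    then show "((\<lambda>s. norm (Gx (x, s))) has_real_derivative (Gtx (x, s) \<bullet> sgn (Gx (x, s)))) (at s within {0<..<T})"
      by (rule has_field_derivative_at_within)
  next
    fix s :: real assume "s \<in> {0<..<T}"
    then show "(\<lambda>x. norm (Gx (x, s))) integrable_on cbox 0 1"
      by (auto intro!: integrable_continuous_real continuous_intros continuous_on_partials)
  next
    show "continuous_on ({0<..<T} \<times> cbox 0 1) (\<lambda>(s, x). Gtx (x, s) \<bullet> sgn (Gx (x, s)))"
      by (auto simp: case_prod_unfold sgn_div_norm Gx_nz intro!: continuous_intros continuous_on_partials)
  qed (use t in auto)
  then have "((\<lambda>t. integral (cbox 0 1) (\<lambda>x. norm (Gx (x, t)))) has_real_derivative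
      integral (cbox 0 1) (\<lambda>x. Gtx (x, t) \<bullet> sgn (Gx (x, t)))) (at t)"
    using t by (simp add: at_within_open[of t "{0<..<T}"])
  moreover have "Gtx (x, t) \<bullet> sgn (Gx (x, t)) = kss x * k x * v x" for x
  proof -
    have "v x = norm (Gx (x, t))"
      using fun_cong[OF speed_Gx[OF t'], of x] fun_cong[OF speed_eq, of x] by simp
    then have sgn: "sgn (Gx (x, t)) = vector [Gx (x, t) $ 1 / v x, Gx (x, t) $ 2 / v x]"
      by (simp add: sgn_div_norm vec_eq_iff forall_2 divide_inverse)
    \<comment> \<open>Smoothness and the flow equation each supply a time derivative of the curve at
      a positive time; uniqueness identifies them.\<close>
    have "Gt (y, t) = - (kss y *\<^sub>R unit_normal (\<gamma> t) y)" for y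
    proof -
      have "((\<lambda>t. \<gamma> t y) has_vector_derivative Gt (y, t)) (at t within {0<..<T})"
        using t_deriv[OF t', of y] unfolding G_def by (auto intro: has_vector_derivative_within_subset)
      then have "((\<lambda>t. \<gamma> t y) has_vector_derivative Gt (y, t)) (at t)"
        using t by (simp add: at_within_open[of t "{0<..<T}"])
      moreover have "((\<lambda>t. \<gamma> t y) has_vector_derivative - (kss y *\<^sub>R unit_normal (\<gamma> t) y)) (at t)"
        using flow t unfolding curve_diffusion_flow_def arc_deriv2_curvature_eq[symmetric] by blast
      ultimately show ?thesis by (rule vector_derivative_unique_at)
    qed
    from normal_variation[OF this x_derivs(3)[OF t']] show ?thesis
      by (simp add: sgn Gx_eq[OF t'])
  qed
  ultimately have "((\<lambda>t. integral {0..1} (\<lambda>x. norm (Gx (x, t)))) has_real_derivative - J) (at t)"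
    using kss_integral by (simp add: J_def integral_unique)
  then have "((\<lambda>t. curve_length (\<gamma> t)) has_real_derivative - J) (at t)"
    by (rule has_field_derivative_transform_within_open[where S="{0<..<T}"])
       (use t in \<open>auto simp: curve_length_def speed_Gx\<close>)
  then show ?thesis
    using that energy_bound[OF rot] by (simp add: J_def)
qed

lemma existence_time_bound:
  assumes "rotation_index (\<gamma> 0) = 0"
  shows "T \<le> curve_length (\<gamma> 0) ^ 4 / (768 * pi\<^sup>2)"
\<comment> \<open>The flow lives on times strictly below \<open>T\<close>, so the bound is shown for
  each such \<open>t\<close>.\<close>
proof (rule dense_le)
  fix t assume "t < T"
  show "t \<le> curve_length (\<gamma> 0) ^ 4 / (768 * pi\<^sup>2)"
  proof (cases "0 \<le> t")
    case True
    \<comment> \<open>That \<open>H\<close> does not increase is the estimate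
      \<open>(L^4)' \<le> - 768 pi^2\<close>, where 768 = 4 * 192 and the 4 comes from
      differentiating the fourth power. Dropping \<open>L^4 \<ge> 0\<close> at time \<open>t\<close>
      then bounds \<open>t\<close>.\<close>
    define H where "H s = curve_length (\<gamma> s) ^ 4 + 768 * pi\<^sup>2 * s" for s
    have "H t \<le> H 0"
    proof (rule DERIV_nonpos_imp_decreasing_open[OF True])
      fix s assume s: "0 < s" "s < t"
      then have "rotation_index (\<gamma> s) = 0"
        using rotation_index_preserved[of s] assms \<open>t < T\<close> by auto
      then obtain J where J: "((\<lambda>t. curve_length (\<gamma> t)) has_real_derivative - J) (at s)"
        "192 * pi\<^sup>2 \<le> curve_length (\<gamma> s) ^ 3 * J"
        using length_deriv[of s] s \<open>t < T\<close> by auto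
      have "(H has_real_derivative (4 * curve_length (\<gamma> s) ^ 3 * (- J) + 768 * pi\<^sup>2)) (at s)"
        unfolding H_def[abs_def] by (auto intro!: derivative_eq_intros J(1))
      moreover have "4 * curve_length (\<gamma> s) ^ 3 * (- J) + 768 * pi\<^sup>2 \<le> 0"
        using J(2) by linarith
      ultimately show "\<exists>y. (H has_real_derivative y) (at s) \<and> y \<le> 0"
        by blast
    next
      have "continuous_on {0..t} (\<lambda>t. curve_length (\<gamma> t))"
        using \<open>t < T\<close> by (intro continuous_on_subset[OF length_continuous]) auto
      then show "continuous_on {0..t} H"
        unfolding H_def[abs_def] by (intro continuous_intros)
    qed
    moreover have "0 \<le> curve_length (\<gamma> t) ^ 4" by simp
    ultimately have "768 * pi\<^sup>2 * t \<le> curve_length (\<gamma> 0) ^ 4"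
      unfolding H_def mult_zero_right by linarith
    then show ?thesis by (simp add: pos_le_divide_eq mult.commute)
  next
    case False
    moreover have "0 \<le> curve_length (\<gamma> 0) ^ 4 / (768 * pi\<^sup>2)" by simp
    ultimately show ?thesis by linarith
  qed
qed

end

theorem mainTheorem10:
  fixes \<gamma>\<^sub>0 :: "real \<Rightarrow> real^2"
  assumes "closed_immersed_curve \<gamma>\<^sub>0"
    and "rotation_index \<gamma>\<^sub>0 = 0"
  shows "maximal_existence_time \<gamma>\<^sub>0 \<le> ereal (curve_length \<gamma>\<^sub>0 ^ 4 / (768 * pi\<^sup>2))"
  unfolding maximal_existence_time_def
\<comment> \<open>The maximal time is a supremum over all flows starting at the given curve, so it
  suffices to bound the existence time of each.\<close>
proof (rule Sup_least)
  fix M assume "M \<in> {ereal T | T. T > 0 \<and> (\<exists>\<gamma>. curve_diffusion_flow T \<gamma> \<and> \<gamma> 0 = \<gamma>\<^sub>0)}"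
  then obtain T \<gamma> where "M = ereal T" "curve_diffusion_flow T \<gamma>" "\<gamma> 0 = \<gamma>\<^sub>0"
    by blast
  then show "M \<le> ereal (curve_length \<gamma>\<^sub>0 ^ 4 / (768 * pi\<^sup>2))"
    using flow_of_curves.existence_time_bound[of T \<gamma>] assms(2) by (auto simp: flow_of_curves_def)
qed

end
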